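(* Let $\phi(z)=\frac{az+b}{cz+d}$, with $a,b,c,d\in\mathbb{C}$ and $ad-bc\neq 0$, be a linear fractional self-map of $\mathbb{D}$ such that $a\neq 0$, $c\neq 0$ and $\phi(0)\neq 0$. Then $C_\phi$ is not 2-complex symmetric with $J$ on $H^2(\mathbb{D})$.
   Context: $H^2(\mathbb{D})$ is the Hardy space of analytic functions $f$ on the open unit disk $\mathbb{D}\subset\mathbb{C}$ with $\|f\|^2=\sup_{0<r<1}\frac{1}{2\pi}\int_0^{2\pi}|f(re^{i\theta})|^2d\theta<\infty$, a Hilbert space. For an analytic self-map $\phi$ of $\mathbb{D}$, the composition operator $C_\phi$ is the bounded operator on $H^2(\mathbb{D})$ given by $C_\phi f=f\circ\phi$. $J$ is the conjugation on $H^2(\mathbb{D})$ given by $(Jf)(z)=\overline{f(\bar z)}$. A bounded linear operator $T$ on $H^2(\mathbb{D})$ is said to be 2-complex symmetric with $J$ if $JT^2J-2T^*JTJ+(T^* )^2=0$ (equivalently $JT^2-2T^*JT+(T^* )^2J=0$). A linear fractional self-map of $\mathbb{D}$ is a map $z\mapsto\frac{az+b}{cz+d}$ with $ad-bc\ne0$ that is analytic on $\mathbb{D}$ and maps $\mathbb{D}$ into $\mathbb{D}$. *)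

theory Defs
  imports "HOL-Complex_Analysis.Complex_Analysis"
begin

definition hardy_mean :: "(complex \<Rightarrow> complex) \<Rightarrow> real \<Rightarrow> real" where
  "hardy_mean f r =
     1 / (2 * pi) * integral {0..2 * pi} (\<lambda>t. (cmod (f (of_real r * exp (\<i> * of_real t))))\<^sup>2)"

text \<open>
  A function on the open unit disk is represented by its extension by \<open>0\<close> to the whole plane, so
  that equality of HOL functions is equality on the disk.
\<close>

definition hardy_space :: "(complex \<Rightarrow> complex) set" where
  "hardy_space = {f. f holomorphic_on ball 0 1 \<and> (\<forall>z. z \<notin> ball 0 1 \<longrightarrow> f z = 0) \<and>
                     bdd_above (hardy_mean f ` {0<..<1})}"

definition hardy_norm :: "(complex \<Rightarrow> complex) \<Rightarrow> real" where
  "hardy_norm f = sqrt (SUP r\<in>{0<..<1}. hardy_mean f r)"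

text \<open>
  The inner product is recovered from the Hilbert space norm by polarization; it is linear in the
  first and conjugate-linear in the second argument.
\<close>

definition hardy_inner :: "(complex \<Rightarrow> complex) \<Rightarrow> (complex \<Rightarrow> complex) \<Rightarrow> complex" where
  "hardy_inner f g =
     1 / 4 * (\<Sum>k<4. \<i> ^ k * of_real ((hardy_norm (\<lambda>z. f z + \<i> ^ k * g z))\<^sup>2))"

text \<open>
  The Hilbert space adjoint. The description is meaningful for bounded linear operators \<open>T\<close> on the
  Hardy space and \<open>g\<close> in the Hardy space, where such an \<open>h\<close> exists and is unique.
\<close>

definition hardy_adjoint ::
    "((complex \<Rightarrow> complex) \<Rightarrow> (complex \<Rightarrow> complex)) \<Rightarrow> (complex \<Rightarrow> complex) \<Rightarrow> (complex \<Rightarrow> complex)" where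
  "hardy_adjoint T g =
     (THE h. h \<in> hardy_space \<and> (\<forall>f\<in>hardy_space. hardy_inner (T f) g = hardy_inner f h))"

definition composition_operator ::
    "(complex \<Rightarrow> complex) \<Rightarrow> (complex \<Rightarrow> complex) \<Rightarrow> (complex \<Rightarrow> complex)" where
  "composition_operator \<phi> f = (\<lambda>z. if z \<in> ball 0 1 then f (\<phi> z) else 0)"

definition hardy_conjugation :: "(complex \<Rightarrow> complex) \<Rightarrow> (complex \<Rightarrow> complex)" where
  "hardy_conjugation f = (\<lambda>z. cnj (f (cnj z)))"

text \<open>
  The equation \<open>C T\<^sup>2 C - 2 T* C T C + (T*)\<^sup>2 = 0\<close> on the Hardy space, for a bounded linear
  operator \<open>T\<close> and a conjugation \<open>C\<close>. Boundedness is not a conjunct, so that the negation of the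
  predicate says that the equation itself fails.
\<close>

definition two_complex_symmetric_with ::
    "((complex \<Rightarrow> complex) \<Rightarrow> (complex \<Rightarrow> complex)) \<Rightarrow>
     ((complex \<Rightarrow> complex) \<Rightarrow> (complex \<Rightarrow> complex)) \<Rightarrow> bool" where
  "two_complex_symmetric_with C T \<longleftrightarrow>
     (\<forall>f\<in>hardy_space.
        (\<lambda>z. C (T (T (C f))) z - 2 * hardy_adjoint T (C (T (C f))) z
              + hardy_adjoint T (hardy_adjoint T f) z) = (\<lambda>z. 0))"

text \<open>
  Division by zero is total in HOL, but under \<open>a * d - b * c \<noteq> 0\<close> a zero of the denominator
  in the disk makes the quotient discontinuous there, so holomorphy excludes poles in the disk.
\<close>

definition linear_fractional_self_map ::
    "complex \<Rightarrow> complex \<Rightarrow> complex \<Rightarrow> complex \<Rightarrow> (complex \<Rightarrow> complex) \<Rightarrow> bool" where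
  "linear_fractional_self_map a b c d \<phi> \<longleftrightarrow>
     a * d - b * c \<noteq> 0 \<and> \<phi> = (\<lambda>z. (a * z + b) / (c * z + d)) \<and>
     \<phi> holomorphic_on ball 0 1 \<and> \<phi> ` ball 0 1 \<subseteq> ball 0 1"

end

(* Apply the defining identity to the constant function 1. Since C_phi 1 = 1 and the adjoint of
   C_phi sends the reproducing kernel K_w to K_(phi w), with 1 = K_0, the identity becomes
   1 - 2 K_p + K_q = 0 for p = phi 0 and q = phi p. Comparing Taylor coefficients gives q = 2 p
   and q^2 = 2 p^2, so p = 0. That C_phi maps the Hardy space into itself is Littlewood's
   subordination principle, proved here through the Poisson majorant of |f|^2. Subordination under
   z -> r z also shows that the circle means increase, which turns the supremum in
   the norm into a limit and the polarized inner product into a limit of Cauchy integrals. *)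
theory Submission
  imports Defs
begin

section \<open>Kernels of the disk and Cauchy's formula in the angle variable\<close>

text \<open>Since \<open>|1 - cnj w * cis t| = |cis t - w|\<close>, this is the usual Poisson kernel
  for \<open>w\<close> in the disk. It carries no factor \<open>1 / (2 * pi)\<close>, so its
  integral over a period is \<open>2 * pi\<close>.\<close>

definition poisson_kernel :: "complex \<Rightarrow> real \<Rightarrow> real" where
  "poisson_kernel w t = (1 - (cmod w)\<^sup>2) / (cmod (1 - cnj w * cis t))\<^sup>2"

text \<open>The reproducing kernel of the Hardy space at \<open>w\<close>, cut off outside the disk
  as membership in \<open>hardy_space\<close> demands.\<close>

definition szego_kernel :: "complex \<Rightarrow> complex \<Rightarrow> complex" where
  "szego_kernel w = (\<lambda>z. if z \<in> ball 0 1 then 1 / (1 - cnj w * z) else 0)"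

lemma hardy_mean_cis:
  "hardy_mean f r = 1 / (2 * pi) * integral {0..2 * pi} (\<lambda>t. (cmod (f (of_real r * cis t)))\<^sup>2)"
  by (simp add: hardy_mean_def cis_conv_exp)

lemma one_minus_mult_nonzero:
  fixes w z :: complex
  assumes "cmod w < 1" "cmod z \<le> 1"
  shows "1 - w * z \<noteq> 0"
proof
  assume "1 - w * z = 0"
  then have "cmod w * cmod z = 1"
    by (metis eq_iff_diff_eq_0 norm_mult norm_one)
  moreover have "cmod w * cmod z \<le> cmod w * 1"
    using assms by (intro mult_left_mono) auto
  ultimately show False using assms by simp
qed

text \<open>Put \<open>u = r * cis t\<close> in Cauchy's formula: \<open>du / (u - w)\<close>
  becomes \<open>\<i> * dt / (1 - w / u)\<close>, and \<open>1 / cis t = cnj (cis t)\<close>. The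
  conjugate in the denominator is what later matches the conjugated kernels.\<close>

lemma cauchy_integral_cis:
  fixes g :: "complex \<Rightarrow> complex"
  assumes "continuous_on (cball 0 r) g" "g holomorphic_on ball 0 r" "cmod w < r"
  shows "((\<lambda>t. g (of_real r * cis t) / (1 - w * cnj (cis t) / of_real r))
            has_integral (2 * pi * g w)) {0..2 * pi}"
proof -
  have r: "r > 0" using assms(3) norm_ge_zero[of w] by linarith
  have "((\<lambda>u. g u / (u - w)) has_contour_integral (2 * of_real pi * \<i> * g w)) (circlepath 0 r)"
    using Cauchy_integral_circlepath[OF assms(1,2)] assms(3) by simp
  then have "((\<lambda>t. g (of_real r * cis t) / (of_real r * cis t - w) * of_real r * \<i> * cis t)
      has_integral (2 * of_real pi * \<i> * g w)) {0..2 * pi}"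
    by (simp add: circlepath_def has_contour_integral_part_circlepath_iff)
  then have "((\<lambda>t. (g (of_real r * cis t) / (of_real r * cis t - w) * of_real r * \<i> * cis t) * (- \<i>))
      has_integral ((2 * of_real pi * \<i> * g w) * (- \<i>))) {0..2 * pi}"
    by (rule has_integral_mult_left)
  moreover have "(g (of_real r * cis t) / (of_real r * cis t - w) * of_real r * \<i> * cis t) * (- \<i>)
      = g (of_real r * cis t) / (1 - w * cnj (cis t) / of_real r)" for t
  proof -
    have "cnj (cis t) = 1 / cis t"
      by (simp add: cis_cnj divide_inverse)
    then have "1 - w * cnj (cis t) / of_real r = (of_real r * cis t - w) / (of_real r * cis t)"
      using r by (simp add: field_simps)
    moreover have "x * of_real r * \<i> * cis t * - \<i> = x * (of_real r * cis t)" for x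
      by (simp add: algebra_simps)
    ultimately show ?thesis by (simp only:) simp
  qed
  moreover have "(2 * of_real pi * \<i> * g w) * (- \<i>) = of_real (2 * pi) * g w"
    by (simp add: algebra_simps)
  ultimately show ?thesis by (simp only:)
qed

section \<open>Poisson integrals\<close>

text \<open>For fixed \<open>t\<close> the right side is the real part of a function holomorphic in
  \<open>w\<close>; this harmonicity survives composition with a holomorphic self-map.\<close>

lemma poisson_kernel_eq_Re:
  assumes "cmod w < 1"
  shows "poisson_kernel w t = Re ((1 + cnj (cis t) * w) / (1 - cnj (cis t) * w))"
proof -
  define u where "u = cnj (cis t) * w"
  have n: "cmod u = cmod w" by (simp add: u_def norm_mult)
  have "cnj (1 - u) = 1 - cnj w * cis t"
    by (simp add: u_def mult.commute)
  then have m: "cmod (1 - cnj w * cis t) = cmod (1 - u)" by (metis complex_mod_cnj)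
  have "Re ((1 + u) / (1 - u)) = Re ((1 + u) * cnj (1 - u)) / (cmod (1 - u))\<^sup>2"
    by (metis Re_complex_div_eq_0 complex_div_cnj Re_divide_of_real of_real_power)
  also have "Re ((1 + u) * cnj (1 - u)) = 1 - (cmod u)\<^sup>2"
    unfolding cmod_power2 by (simp add: algebra_simps power2_eq_square)
  finally show ?thesis unfolding poisson_kernel_def m n[symmetric] by (simp add: u_def)
qed

lemma poisson_kernel_nonneg: "cmod w < 1 \<Longrightarrow> poisson_kernel w t \<ge> 0"
  by (simp add: poisson_kernel_def abs_square_le_1)

text \<open>Harnack's bound, from the reverse triangle inequality in the denominator. It supplies
  the constant in the subordination principle.\<close>

lemma poisson_kernel_le:
  assumes "cmod w < 1"
  shows "poisson_kernel w t \<le> (1 + cmod w) / (1 - cmod w)"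
proof -
  have "1 - cmod w \<le> cmod (1 - cnj w * cis t)"
    using norm_triangle_ineq2[of 1 "cnj w * cis t"] by (simp add: norm_mult)
  then have "poisson_kernel w t \<le> (1 - (cmod w)\<^sup>2) / (1 - cmod w)\<^sup>2"
    unfolding poisson_kernel_def using assms
    by (intro divide_left_mono power_mono) (auto simp: abs_square_le_1 intro!: mult_pos_pos)
  also have "\<dots> = (1 + cmod w) / (1 - cmod w)"
    using assms by (simp add: divide_simps power2_eq_square) (simp add: algebra_simps)
  finally show ?thesis .
qed

lemma continuous_on_poisson_kernel [continuous_intros]:
  assumes "continuous_on S f" "continuous_on S g" "\<And>x. x \<in> S \<Longrightarrow> cmod (f x) < 1"
  shows "continuous_on S (\<lambda>x. poisson_kernel (f x) (g x))"
proof -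
  have "1 - cnj (f x) * cis (g x) \<noteq> 0" if "x \<in> S" for x
    using one_minus_mult_nonzero[of "cnj (f x)" "cis (g x)"] assms(3)[OF that] by simp
  then show ?thesis
    unfolding poisson_kernel_def cis_conv_exp
    by (intro continuous_intros assms(1,2)) (auto simp: cis_conv_exp)
qed

text \<open>Cauchy's formula is applied not to \<open>f\<close> but to \<open>g\<close>, which has
  the extra factor \<open>(1 - |w|^2) / (1 - cnj w * z)\<close>. On the circle this factor and the
  Cauchy denominator combine to the Poisson kernel, and at \<open>z = w\<close> it equals 1.\<close>

lemma has_integral_poisson_kernel:
  fixes f :: "complex \<Rightarrow> complex"
  assumes "continuous_on (cball 0 1) f" "f holomorphic_on ball 0 1" "cmod w < 1"
  shows "((\<lambda>t. of_real (poisson_kernel w t) * f (cis t)) has_integral (2 * pi * f w)) {0..2 * pi}"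
proof -
  define g where "g = (\<lambda>z. of_real (1 - (cmod w)\<^sup>2) * f z / (1 - cnj w * z))"
  have nz: "1 - cnj w * z \<noteq> 0" if "cmod z \<le> 1" for z
    using one_minus_mult_nonzero[of "cnj w" z] assms(3) that by simp
  have "continuous_on (cball 0 1) g" "g holomorphic_on ball 0 1"
    unfolding g_def using nz by (auto intro!: continuous_intros holomorphic_intros assms)
  from cauchy_integral_cis[OF this assms(3)]
  have "((\<lambda>t. g (cis t) / (1 - w * cnj (cis t))) has_integral (2 * pi * g w)) {0..2 * pi}"
    by simp
  moreover have "g (cis t) / (1 - w * cnj (cis t)) = of_real (poisson_kernel w t) * f (cis t)" for t
  proof -
    have "(1 - cnj w * cis t) * (1 - w * cnj (cis t)) = of_real ((cmod (1 - cnj w * cis t))\<^sup>2)"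
      by (simp only: complex_norm_square) simp
    then show ?thesis
      by (simp add: g_def poisson_kernel_def)
  qed
  moreover have "g w = f w"
  proof -
    have "of_real (1 - (cmod w)\<^sup>2) = 1 - cnj w * w"
      using complex_norm_square[of w] by (simp add: mult.commute)
    then show ?thesis using nz[of w] assms(3) by (simp add: g_def)
  qed
  ultimately show ?thesis by simp
qed

text \<open>Jensen's inequality for the Poisson measure, read off from the integral of the
  nonnegative function \<open>P |f - f(w)|\<^sup>2\<close>.\<close>
lemma cmod_square_le_poisson:
  assumes f: "continuous_on (cball 0 1) f" "f holomorphic_on ball 0 1" and w: "cmod w < 1"
  shows "2 * pi * (cmod (f w))\<^sup>2 \<le> integral {0..2 * pi} (\<lambda>t. poisson_kernel w t * (cmod (f (cis t)))\<^sup>2)"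
proof -
  let ?P = "poisson_kernel w"
  have cf: "continuous_on {0..2 * pi} (\<lambda>t. f (cis t))"
    by (rule continuous_on_compose2[OF f(1)]) (auto simp: cis_conv_exp intro!: continuous_intros)
  have "continuous_on {0..2 * pi} (\<lambda>t. ?P t * (cmod (f (cis t)))\<^sup>2)"
    using w by (intro continuous_intros cf) auto
  then have i1: "((\<lambda>t. ?P t * (cmod (f (cis t)))\<^sup>2) has_integral
      integral {0..2 * pi} (\<lambda>t. ?P t * (cmod (f (cis t)))\<^sup>2)) {0..2 * pi}"
    by (intro integrable_integral integrable_continuous_real)
  have i2: "(?P has_integral 2 * pi) {0..2 * pi}"
    using has_integral_Re[OF has_integral_poisson_kernel[of "\<lambda>_. 1", OF _ _ w]] by simp
  \<comment> \<open>The cross term of \<open>|f - f(w)|^2\<close> is the real part of a constant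
    multiple of \<open>f\<close>, so Poisson's formula evaluates it.\<close>
  have "((\<lambda>t. cnj (f w) * (of_real (?P t) * f (cis t))) has_integral
      (cnj (f w) * (2 * pi * f w))) {0..2 * pi}"
    by (intro has_integral_mult_right has_integral_poisson_kernel f w)
  from has_integral_Re[OF this]
  have i3: "((\<lambda>t. ?P t * Re (cnj (f w) * f (cis t))) has_integral 2 * pi * (cmod (f w))\<^sup>2) {0..2 * pi}"
    unfolding cmod_power2 by (simp add: algebra_simps power2_eq_square)
  have "((\<lambda>t. ?P t * (cmod (f (cis t)))\<^sup>2 - 2 * (?P t * Re (cnj (f w) * f (cis t)))
            + ?P t * (cmod (f w))\<^sup>2) has_integral
      (integral {0..2 * pi} (\<lambda>t. ?P t * (cmod (f (cis t)))\<^sup>2) - 2 * (2 * pi * (cmod (f w))\<^sup>2)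
        + 2 * pi * (cmod (f w))\<^sup>2)) {0..2 * pi}"
    by (intro has_integral_add has_integral_diff i1 has_integral_mult_right i3 has_integral_mult_left i2)
  moreover have "?P t * (cmod (f (cis t)))\<^sup>2 - 2 * (?P t * Re (cnj (f w) * f (cis t)))
            + ?P t * (cmod (f w))\<^sup>2 = ?P t * (cmod (f (cis t) - f w))\<^sup>2" for t
    unfolding cmod_power2 by (simp add: algebra_simps power2_eq_square)
  ultimately have "integral {0..2 * pi} (\<lambda>t. ?P t * (cmod (f (cis t)))\<^sup>2)
      - 2 * (2 * pi * (cmod (f w))\<^sup>2) + 2 * pi * (cmod (f w))\<^sup>2 \<ge> 0"
    by (elim has_integral_nonneg) (simp add: poisson_kernel_nonneg w)
  then show ?thesis by simp
qed

text \<open>The mean value property of a harmonic function of the point: the kernel composed with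
  \<open>\<psi>\<close> is the real part of the holomorphic \<open>g\<close>, and Cauchy's formula
  at the centre 0 gives its circle mean.\<close>

lemma has_integral_poisson_kernel_compose:
  assumes psi: "\<psi> holomorphic_on ball 0 1" "\<psi> ` ball 0 1 \<subseteq> ball 0 1" and s: "0 < s" "s < 1"
  shows "((\<lambda>\<theta>. poisson_kernel (\<psi> (of_real s * cis \<theta>)) t) has_integral
            2 * pi * poisson_kernel (\<psi> 0) t) {0..2 * pi}"
proof -
  define g where "g = (\<lambda>z. (1 + cnj (cis t) * \<psi> z) / (1 - cnj (cis t) * \<psi> z))"
  have lt: "cmod (\<psi> z) < 1" if "cmod z < 1" for z
    using psi(2) that by (force simp: image_subset_iff)
  have nz: "1 - cnj (cis t) * \<psi> z \<noteq> 0" if "cmod z < 1" for z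
    using one_minus_mult_nonzero[OF lt[OF that], of "cnj (cis t)"] by (simp add: mult.commute)
  have "g holomorphic_on ball 0 1"
    unfolding g_def using nz by (auto intro!: holomorphic_intros psi)
  moreover have "cball 0 s \<subseteq> ball (0::complex) 1" "ball 0 s \<subseteq> ball (0::complex) 1"
    using s by auto
  ultimately have "continuous_on (cball 0 s) g" "g holomorphic_on ball 0 s"
    by (meson holomorphic_on_imp_continuous_on holomorphic_on_subset)+
  from has_integral_Re[OF cauchy_integral_cis[OF this, of 0]] s
  have "((\<lambda>\<theta>. Re (g (of_real s * cis \<theta>))) has_integral 2 * pi * Re (g 0)) {0..2 * pi}"
    by simp
  moreover have "Re (g z) = poisson_kernel (\<psi> z) t" if "cmod z < 1" for z
    unfolding g_def using poisson_kernel_eq_Re[OF lt[OF that]] by simp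
  ultimately show ?thesis
    using s by (simp add: norm_mult)
qed

section \<open>Littlewood's subordination principle\<close>

lemma continuous_on_circle:
  assumes "f holomorphic_on ball 0 1" "0 < r" "r < 1"
  shows "continuous_on S (\<lambda>t. f (of_real r * cis t))"
  by (rule continuous_on_compose2[OF holomorphic_on_imp_continuous_on[OF assms(1)]])
    (use assms in \<open>auto simp: norm_mult cis_conv_exp intro!: continuous_intros\<close>)

text \<open>The dilation by \<open>r\<close> makes \<open>f\<close> continuous up to the circle.\<close>
lemma littlewood_subordination_dilated:
  assumes f: "f holomorphic_on ball 0 1"
    and psi: "\<psi> holomorphic_on ball 0 1" "\<psi> ` ball 0 1 \<subseteq> ball 0 1"
    and r: "0 < r" "r < 1" and s: "0 < s" "s < 1"
  shows "hardy_mean (\<lambda>z. f (of_real r * \<psi> z)) s \<le>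
           (1 + cmod (\<psi> 0)) / (1 - cmod (\<psi> 0)) * hardy_mean f r"
proof -
  let ?I = "{0..2 * pi}"
  let ?C = "(1 + cmod (\<psi> 0)) / (1 - cmod (\<psi> 0))"
  let ?F = "\<lambda>t. (cmod (f (of_real r * cis t)))\<^sup>2"
  let ?w = "\<lambda>\<theta>. \<psi> (of_real s * cis \<theta>)"
  have lt: "cmod (\<psi> z) < 1" if "cmod z < 1" for z
    using psi(2) that by (force simp: image_subset_iff)
  have w: "cmod (?w \<theta>) < 1" for \<theta>
    using s by (intro lt) (simp add: norm_mult)
  have cw: "continuous_on S ?w" for S using continuous_on_circle psi(1) s by blast
  have cF: "continuous_on S ?F" for S
    by (intro continuous_intros continuous_on_circle f r)
  have hol: "(\<lambda>z. f (of_real r * z)) holomorphic_on ball 0 (1 / r)"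
    by (rule holomorphic_on_compose_gen[OF _ f, unfolded o_def])
      (use r in \<open>auto intro!: holomorphic_intros simp: norm_mult field_simps\<close>)
  have sub: "cball 0 1 \<subseteq> ball (0::complex) (1 / r)" "ball 0 1 \<subseteq> ball (0::complex) (1 / r)"
    using r by (auto simp: field_simps intro: less_le_trans le_less_trans)
       (smt (verit) mult_less_cancel_left2 mult_le_cancel_left1 norm_ge_zero mult_left_le)+
  have hol': "continuous_on (cball 0 1) (\<lambda>z. f (of_real r * z))"
    "(\<lambda>z. f (of_real r * z)) holomorphic_on ball 0 1"
    using hol sub by (meson holomorphic_on_imp_continuous_on holomorphic_on_subset)+
  \<comment> \<open>Jensen's inequality for the dilate of \<open>f\<close>, at the image point
    \<open>\<psi> (of_real s * cis \<theta>)\<close>.\<close>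
  have pm: "2 * pi * (cmod (f (of_real r * ?w \<theta>)))\<^sup>2 \<le>
      integral ?I (\<lambda>t. poisson_kernel (?w \<theta>) t * ?F t)" for \<theta>
    using cmod_square_le_poisson[OF hol' w] by simp
  have cfw: "continuous_on ?I (\<lambda>\<theta>. f (of_real r * ?w \<theta>))"
    by (rule continuous_on_compose2[OF holomorphic_on_imp_continuous_on[OF hol'(2)] cw])
      (use w in auto)
  have cP: "continuous_on (cbox (0, 0) (2 * pi, 2 * pi))
      (\<lambda>(\<theta>, t). poisson_kernel (?w \<theta>) t * ?F t)"
    unfolding split_beta
    by (intro continuous_intros continuous_on_compose2[OF cF continuous_on_snd]
        continuous_on_compose2[OF cw continuous_on_fst]) (use w in \<open>auto\<close>)
  have cP2: "continuous_on ?I (\<lambda>\<theta>. integral ?I (\<lambda>t. poisson_kernel (?w \<theta>) t * ?F t))"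
    using integral_continuous_on_param[of ?I 0 "2 * pi" "\<lambda>\<theta> t. poisson_kernel (?w \<theta>) t * ?F t"] cP
    by (simp add: cbox_Pair_eq)
  \<comment> \<open>Integrate the pointwise bound over \<open>\<theta>\<close> and swap the
    integrals. The inner integral then averages the kernel to its value at \<open>\<psi> 0\<close>,
    which Harnack's bound replaces by \<open>?C\<close>.\<close>
  have "2 * pi * integral ?I (\<lambda>\<theta>. (cmod (f (of_real r * ?w \<theta>)))\<^sup>2)
      = integral ?I (\<lambda>\<theta>. 2 * pi * (cmod (f (of_real r * ?w \<theta>)))\<^sup>2)" by simp
  also have "\<dots> \<le> integral ?I (\<lambda>\<theta>. integral ?I (\<lambda>t. poisson_kernel (?w \<theta>) t * ?F t))"
    by (intro integral_le integrable_continuous_real pm cP2 continuous_intros cfw)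
  also have "\<dots> = integral ?I (\<lambda>t. integral ?I (\<lambda>\<theta>. poisson_kernel (?w \<theta>) t * ?F t))"
    using integral_swap_continuous[OF cP] by simp
  also have "\<dots> = integral ?I (\<lambda>t. 2 * pi * (poisson_kernel (\<psi> 0) t * ?F t))"
    by (simp add: integral_unique[OF has_integral_poisson_kernel_compose[OF psi s]] mult.assoc)
  also have "\<dots> \<le> integral ?I (\<lambda>t. 2 * pi * (?C * ?F t))"
  proof (intro integral_le integrable_continuous_real continuous_intros continuous_on_circle f r)
    show "2 * pi * (poisson_kernel (\<psi> 0) t * ?F t) \<le> 2 * pi * (?C * ?F t)" for t
      using lt[of 0] by (intro mult_left_mono mult_right_mono poisson_kernel_le) auto
  qed (use lt[of 0] in simp_all)
  also have "\<dots> = 2 * pi * (?C * integral ?I ?F)" by simp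
  finally have "integral ?I (\<lambda>\<theta>. (cmod (f (of_real r * ?w \<theta>)))\<^sup>2) \<le> ?C * integral ?I ?F"
    by (subst (asm) mult_le_cancel_left_pos) auto
  then have "1 / (2 * pi) * integral ?I (\<lambda>\<theta>. (cmod (f (of_real r * ?w \<theta>)))\<^sup>2)
      \<le> 1 / (2 * pi) * (?C * integral ?I ?F)"
    by (intro mult_left_mono) auto
  then show ?thesis
    unfolding hardy_mean_cis by (simp only: mult.left_commute)
qed

text \<open>Subordination for the identity map, whose value 0 at 0 makes the constant 1. Dilating by
  \<open>s\<close> turns the circle of radius \<open>r / s\<close> into that of radius
  \<open>r\<close>.\<close>

lemma hardy_mean_mono:
  assumes "f holomorphic_on ball 0 1" "0 < r" "r \<le> s" "s < 1"
  shows "hardy_mean f r \<le> hardy_mean f s"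
proof (cases "r = s")
  case False
  with assms littlewood_subordination_dilated[of f "\<lambda>z. z" s "r / s"]
  have "hardy_mean (\<lambda>z. f (of_real s * z)) (r / s) \<le> hardy_mean f s" by simp
  moreover have "of_real s * (of_real (r / s) * cis t) = of_real r * cis t" for t
    using assms by simp
  ultimately show ?thesis unfolding hardy_mean_cis by simp
qed simp

text \<open>The dilated estimate is bounded by \<open>?C * M\<close> for every dilation factor
  \<open>r < 1\<close>, so the bound persists as \<open>r\<close> tends to 1.\<close>

lemma hardy_space_compose:
  assumes f: "f \<in> hardy_space"
    and psi: "\<psi> holomorphic_on ball 0 1" "\<psi> ` ball 0 1 \<subseteq> ball 0 1"
  shows "composition_operator \<psi> f \<in> hardy_space"
proof -
  let ?C = "(1 + cmod (\<psi> 0)) / (1 - cmod (\<psi> 0))"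
  have hf: "f holomorphic_on ball 0 1" and "bdd_above (hardy_mean f ` {0<..<1})"
    using f by (auto simp: hardy_space_def)
  then obtain M where M: "\<And>r. 0 < r \<Longrightarrow> r < 1 \<Longrightarrow> hardy_mean f r \<le> M"
    unfolding bdd_above_def by (metis greaterThanLessThan_iff imageI)
  have lt: "cmod (\<psi> z) < 1" if "cmod z < 1" for z
    using psi(2) that by (force simp: image_subset_iff)
  have C: "?C \<ge> 0" using lt[of 0] by simp
  have bd: "hardy_mean (\<lambda>z. f (\<psi> z)) s \<le> ?C * M" if s: "0 < s" "s < 1" for s
  proof -
    have cw: "continuous_on S (\<lambda>\<theta>. \<psi> (of_real s * cis \<theta>))" for S
      using continuous_on_circle psi(1) s by blast
    \<comment> \<open>For fixed \<open>s < 1\<close> the points stay inside the disk even at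
      \<open>r = 1\<close>; hence the mean is continuous in \<open>r\<close> up to that
      endpoint.\<close>
    have "cmod (of_real r * \<psi> (of_real s * cis \<theta>)) < 1" if "r \<in> {0..1}" for r \<theta>
    proof -
      have "cmod (\<psi> (of_real s * cis \<theta>)) < 1" using s by (intro lt) (simp add: norm_mult)
      moreover have "cmod (of_real r * \<psi> (of_real s * cis \<theta>)) \<le> 1 * cmod (\<psi> (of_real s * cis \<theta>))"
        unfolding norm_mult using that by (intro mult_right_mono) auto
      ultimately show ?thesis by linarith
    qed
    then have "continuous_on ({0..1} \<times> {0..2 * pi})
        (\<lambda>(r, \<theta>). (cmod (f (of_real r * \<psi> (of_real s * cis \<theta>))))\<^sup>2)"
      unfolding split_beta
      by (intro continuous_on_power continuous_on_norm continuous_on_compose2[OF holomorphic_on_imp_continuous_on[OF hf]]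
        continuous_intros continuous_on_compose2[OF cw continuous_on_snd]) auto
    then have c: "continuous_on {0..1} (\<lambda>r. hardy_mean (\<lambda>z. f (of_real r * \<psi> z)) s)"
      unfolding hardy_mean_cis
      using integral_continuous_on_param[of "{0..1}" 0 "2 * pi"
          "\<lambda>r \<theta>. (cmod (f (of_real r * \<psi> (of_real s * cis \<theta>))))\<^sup>2"]
      by (intro continuous_on_mult_left) simp
    have "((\<lambda>r. hardy_mean (\<lambda>z. f (of_real r * \<psi> z)) s) \<longlongrightarrow> hardy_mean (\<lambda>z. f (\<psi> z)) s) (at_left 1)"
      using c by (auto simp: continuous_on_def at_within_Icc_at_left dest!: bspec[of _ _ 1])
    moreover have "\<forall>\<^sub>F r in at_left 1. hardy_mean (\<lambda>z. f (of_real r * \<psi> z)) s \<le> ?C * M"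
      using eventually_at_left_real[of 0 1]
    proof (rule eventually_mono, goal_cases)
      case (2 r)
      then have "hardy_mean (\<lambda>z. f (of_real r * \<psi> z)) s \<le> ?C * hardy_mean f r"
        by (intro littlewood_subordination_dilated hf psi s) auto
      also have "\<dots> \<le> ?C * M" using 2 by (intro mult_left_mono M C) auto
      finally show ?case .
    qed simp
    ultimately show ?thesis
      by (rule tendsto_upperbound) simp
  qed
  have eq: "hardy_mean (composition_operator \<psi> f) s = hardy_mean (\<lambda>z. f (\<psi> z)) s"
    if "s \<in> {0<..<1}" for s
    using that by (simp add: hardy_mean_cis composition_operator_def norm_mult)
  have "(\<lambda>z. f (\<psi> z)) holomorphic_on ball 0 1"
    using holomorphic_on_compose_gen[OF psi(1) hf psi(2)] by (simp add: o_def)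
  then have "composition_operator \<psi> f holomorphic_on ball 0 1"
    by (rule holomorphic_transform) (simp add: composition_operator_def)
  moreover have "bdd_above (hardy_mean (composition_operator \<psi> f) ` {0<..<1})"
    by (rule bdd_aboveI2[where M = "?C * M"]) (use bd eq in auto)
  ultimately show ?thesis
    by (auto simp: hardy_space_def composition_operator_def)
qed

section \<open>Norm and inner product as radial limits\<close>

text \<open>The circle means increase with the radius, so their supremum is their limit at
  1.\<close>

lemma hardy_norm_square_tendsto:
  assumes "f \<in> hardy_space"
  shows "(hardy_mean f \<longlongrightarrow> (hardy_norm f)\<^sup>2) (at_left 1)"
proof -
  let ?S = "SUP r\<in>{0<..<1}. hardy_mean f r"
  have hf: "f holomorphic_on ball 0 1" and bdd: "bdd_above (hardy_mean f ` {0<..<1})"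
    using assms by (auto simp: hardy_space_def)
  have up: "hardy_mean f r \<le> ?S" if "0 < r" "r < 1" for r
    using bdd that by (intro cSUP_upper) auto
  \<comment> \<open>One nonnegative mean makes the supremum nonnegative, so that squaring undoes the
    \<open>sqrt\<close> in \<open>hardy_norm\<close>; the radius 1/2 is arbitrary.\<close>
  have "hardy_mean f (1/2) \<ge> 0"
    unfolding hardy_mean_cis
    by (intro mult_nonneg_nonneg integral_nonneg integrable_continuous_real continuous_intros
        continuous_on_circle hf) auto
  then have "?S \<ge> 0" using up[of "1/2"] by simp
  then have n: "(hardy_norm f)\<^sup>2 = ?S" by (simp add: hardy_norm_def)
  show ?thesis unfolding n
  proof (rule order_tendstoI)
    fix a assume "a < ?S"
    then obtain r where r: "0 < r" "r < 1" "a < hardy_mean f r"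
      using bdd by (subst (asm) less_cSUP_iff) auto
    show "\<forall>\<^sub>F s in at_left 1. a < hardy_mean f s"
      using eventually_at_left_real[OF r(2)]
    proof (rule eventually_mono)
      fix s assume "s \<in> {r<..<1}"
      then show "a < hardy_mean f s"
        using hardy_mean_mono[OF hf r(1), of s] r(3) by simp
    qed
  next
    fix a assume "?S < a"
    show "\<forall>\<^sub>F s in at_left 1. hardy_mean f s < a"
      using eventually_at_left_real[of 0 1]
    proof (rule eventually_mono, goal_cases)
      case (2 s)
      then show ?case using up[of s] \<open>?S < a\<close> by simp
    qed simp
  qed
qed

text \<open>Integrating \<open>|x + c y|^2 \<le> 2 |x|^2 + 2 |c|^2 |y|^2\<close> over circles bounds
  the means. Polarization needs this for \<open>c = \<i> ^ k\<close>.\<close>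

lemma hardy_space_add_scale:
  assumes f: "f \<in> hardy_space" and g: "g \<in> hardy_space"
  shows "(\<lambda>z. f z + c * g z) \<in> hardy_space"
proof -
  have hf: "f holomorphic_on ball 0 1" and hg: "g holomorphic_on ball 0 1"
    and "bdd_above (hardy_mean f ` {0<..<1})" "bdd_above (hardy_mean g ` {0<..<1})"
    using f g by (auto simp: hardy_space_def)
  then obtain M N where M: "\<And>r. 0 < r \<Longrightarrow> r < 1 \<Longrightarrow> hardy_mean f r \<le> M"
    and N: "\<And>r. 0 < r \<Longrightarrow> r < 1 \<Longrightarrow> hardy_mean g r \<le> N"
    unfolding bdd_above_def by (metis greaterThanLessThan_iff imageI)
  have sq: "(cmod (x + c * y))\<^sup>2 \<le> 2 * (cmod x)\<^sup>2 + 2 * (cmod c)\<^sup>2 * (cmod y)\<^sup>2" for x y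
  proof -
    have "(cmod (x + c * y))\<^sup>2 \<le> (cmod x + cmod c * cmod y)\<^sup>2"
      by (intro power_mono) (metis norm_triangle_ineq norm_mult, simp)
    also have "\<dots> \<le> 2 * (cmod x)\<^sup>2 + 2 * (cmod c * cmod y)\<^sup>2"
      using sum_squares_bound[of "cmod x" "cmod c * cmod y"]
      by (simp add: power2_eq_square algebra_simps)
    finally show ?thesis by (simp add: power_mult_distrib)
  qed
  have "hardy_mean (\<lambda>z. f z + c * g z) r \<le> 2 * M + 2 * (cmod c)\<^sup>2 * N" if r: "0 < r" "r < 1" for r
  proof -
    have "integral {0..2 * pi} (\<lambda>t. (cmod (f (of_real r * cis t) + c * g (of_real r * cis t)))\<^sup>2)
        \<le> integral {0..2 * pi} (\<lambda>t. 2 * (cmod (f (of_real r * cis t)))\<^sup>2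
              + 2 * (cmod c)\<^sup>2 * (cmod (g (of_real r * cis t)))\<^sup>2)"
      by (intro integral_le integrable_continuous_real continuous_intros continuous_on_circle hf hg r sq)
    also have "\<dots> = 2 * integral {0..2 * pi} (\<lambda>t. (cmod (f (of_real r * cis t)))\<^sup>2)
       + 2 * (cmod c)\<^sup>2 * integral {0..2 * pi} (\<lambda>t. (cmod (g (of_real r * cis t)))\<^sup>2)"
      by (subst integral_add)
        (auto intro!: integrable_continuous_real continuous_intros continuous_on_circle hf hg r)
    finally have "hardy_mean (\<lambda>z. f z + c * g z) r \<le> 2 * hardy_mean f r + 2 * (cmod c)\<^sup>2 * hardy_mean g r"
      unfolding hardy_mean_cis by (simp add: field_simps)
    also have "\<dots> \<le> 2 * M + 2 * (cmod c)\<^sup>2 * N"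
      using M[OF r] N[OF r] by (intro add_mono mult_left_mono) auto
    finally show ?thesis .
  qed
  then have "bdd_above (hardy_mean (\<lambda>z. f z + c * g z) ` {0<..<1})"
    by (intro bdd_aboveI2) auto
  then show ?thesis
    using f g by (auto simp: hardy_space_def intro!: holomorphic_intros)
qed

lemma complex_polarization:
  "(\<Sum>k<4. \<i> ^ k * of_real ((cmod (x + \<i> ^ k * y))\<^sup>2)) = 4 * (x * cnj y)"
proof -
  have "{..<4} = {0, 1, 2, 3::nat}" by auto
  then show ?thesis
    by (simp add: power3_eq_cube complex_eq_iff cmod_power2) (simp add: algebra_simps power2_eq_square)
qed

text \<open>Each of the four squared norms in \<open>hardy_inner\<close> is a limit of circle means.
  At a fixed radius the four means combine, by polarization under the integral, into one integral of
  \<open>f * cnj g\<close>.\<close>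

lemma hardy_inner_tendsto:
  assumes f: "f \<in> hardy_space" and g: "g \<in> hardy_space"
  shows "((\<lambda>r. 1 / (2 * pi) * integral {0..2 * pi}
            (\<lambda>t. f (of_real r * cis t) * cnj (g (of_real r * cis t)))) \<longlongrightarrow> hardy_inner f g) (at_left 1)"
proof -
  have hf: "f holomorphic_on ball 0 1" and hg: "g holomorphic_on ball 0 1"
    using f g by (auto simp: hardy_space_def)
  have "((\<lambda>r. 1 / 4 * (\<Sum>k<4. \<i> ^ k * of_real (hardy_mean (\<lambda>z. f z + \<i> ^ k * g z) r)))
      \<longlongrightarrow> hardy_inner f g) (at_left 1)"
    unfolding hardy_inner_def
    by (intro tendsto_intros hardy_norm_square_tendsto hardy_space_add_scale f g)
  moreover have "\<forall>\<^sub>F r in at_left 1.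
      1 / 4 * (\<Sum>k<4. \<i> ^ k * of_real (hardy_mean (\<lambda>z. f z + \<i> ^ k * g z) r)) =
      1 / (2 * pi) * integral {0..2 * pi} (\<lambda>t. f (of_real r * cis t) * cnj (g (of_real r * cis t)))"
    using eventually_at_left_real[of 0 1]
  proof (rule eventually_mono, goal_cases)
    case (2 r)
    then have r: "0 < r" "r < 1" by auto
    let ?h = "\<lambda>k t. (cmod (f (of_real r * cis t) + \<i> ^ k * g (of_real r * cis t)))\<^sup>2"
    have "((\<lambda>t. \<Sum>k<4. \<i> ^ k * of_real (?h k t)) has_integral
        (\<Sum>k<4. \<i> ^ k * of_real (integral {0..2 * pi} (?h k)))) {0..2 * pi}"
      by (intro has_integral_sum has_integral_mult_right has_integral_of_real integrable_integral
          integrable_continuous_real continuous_intros continuous_on_circle hf hg r) auto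
    then have "integral {0..2 * pi} (\<lambda>t. 4 * (f (of_real r * cis t) * cnj (g (of_real r * cis t))))
        = (\<Sum>k<4. \<i> ^ k * of_real (integral {0..2 * pi} (?h k)))"
      unfolding complex_polarization by (rule integral_unique)
    then have "4 * integral {0..2 * pi} (\<lambda>t. f (of_real r * cis t) * cnj (g (of_real r * cis t)))
        = (\<Sum>k<4. \<i> ^ k * of_real (integral {0..2 * pi} (?h k)))"
      by simp
    \<comment> \<open>Once \<open>1 / (2 * pi)\<close> is pulled out of the sum, the factor 4
      cancels the 1/4 of the polarization formula.\<close>
    then show ?case
      unfolding hardy_mean_cis of_real_mult mult.left_commute[of "_ ^ _"] sum_distrib_left[symmetric]
      by (simp add: field_simps)
  qed simp
  ultimately show ?thesis by (rule Lim_transform_eventually)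
qed

section \<open>Reproducing kernels and the adjoint\<close>

text \<open>The kernel is bounded by \<open>1 / (1 - |w|)\<close>, and a bounded function has
  bounded circle means.\<close>

lemma szego_kernel_in_hardy_space:
  assumes "cmod w < 1"
  shows "szego_kernel w \<in> hardy_space"
proof -
  have nz: "1 - cnj w * z \<noteq> 0" if "cmod z \<le> 1" for z
    using one_minus_mult_nonzero[of "cnj w" z] assms that by simp
  have "(\<lambda>z. 1 / (1 - cnj w * z)) holomorphic_on ball 0 1"
    using nz by (auto intro!: holomorphic_intros)
  then have hol: "szego_kernel w holomorphic_on ball 0 1"
    by (rule holomorphic_transform) (simp add: szego_kernel_def)
  have le: "cmod (szego_kernel w z) \<le> 1 / (1 - cmod w)" for z
  proof (cases "cmod z < 1")
    case True
    have "cmod (cnj w * z) \<le> cmod w * 1"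
      unfolding norm_mult using True by (intro mult_mono) auto
    then have "1 - cmod w \<le> cmod (1 - cnj w * z)"
      using norm_triangle_ineq2[of 1 "cnj w * z"] by simp
    then show ?thesis
      using assms True nz[of z]
      by (auto simp: szego_kernel_def norm_divide intro!: divide_left_mono mult_pos_pos)
  qed (use assms in \<open>simp add: szego_kernel_def\<close>)
  have "hardy_mean (szego_kernel w) r \<le> (1 / (1 - cmod w))\<^sup>2" if r: "0 < r" "r < 1" for r
  proof -
    have "integral {0..2 * pi} (\<lambda>t. (cmod (szego_kernel w (of_real r * cis t)))\<^sup>2)
        \<le> integral {0..2 * pi} (\<lambda>t. (1 / (1 - cmod w))\<^sup>2)"
      by (intro integral_le integrable_continuous_real continuous_intros continuous_on_circle hol r
          power_mono le) auto
    then show ?thesis unfolding hardy_mean_cis by (simp add: field_simps)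
  qed
  then have "bdd_above (hardy_mean (szego_kernel w) ` {0<..<1})"
    by (intro bdd_aboveI2) auto
  with hol show ?thesis by (auto simp: hardy_space_def szego_kernel_def)
qed

text \<open>On the circle of radius \<open>r\<close> the conjugated kernel is
  \<open>1 / (1 - r * w * cnj (cis t))\<close>, which is the Cauchy factor of the point
  \<open>r^2 * w\<close>. Hence \<open>f\<close> is evaluated there and not at
  \<open>w\<close>.\<close>

lemma has_integral_szego_kernel:
  fixes f :: "complex \<Rightarrow> complex"
  assumes f: "f holomorphic_on ball 0 1" and w: "cmod w < 1" and r: "0 < r" "r < 1"
  shows "((\<lambda>t. f (of_real r * cis t) * cnj (szego_kernel w (of_real r * cis t))) has_integral
           (2 * pi * f (of_real (r\<^sup>2) * w))) {0..2 * pi}"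
proof -
  have "cball 0 r \<subseteq> ball (0::complex) 1" "ball 0 r \<subseteq> ball (0::complex) 1"
    using r by auto
  then have "continuous_on (cball 0 r) f" "f holomorphic_on ball 0 r"
    using f by (meson holomorphic_on_imp_continuous_on holomorphic_on_subset)+
  moreover have "cmod (of_real (r\<^sup>2) * w) < r"
  proof -
    have "r * r * cmod w < r * 1 * 1"
      using r w by (intro mult_le_less_imp_less mult_left_mono) auto
    then show ?thesis using r by (simp add: norm_mult power2_eq_square)
  qed
  ultimately have "((\<lambda>t. f (of_real r * cis t) / (1 - of_real (r\<^sup>2) * w * cnj (cis t) / of_real r))
      has_integral (2 * pi * f (of_real (r\<^sup>2) * w))) {0..2 * pi}"
    by (rule cauchy_integral_cis)
  moreover have "f (of_real r * cis t) / (1 - of_real (r\<^sup>2) * w * cnj (cis t) / of_real r)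
      = f (of_real r * cis t) * cnj (szego_kernel w (of_real r * cis t))" for t
    using r by (simp add: szego_kernel_def norm_mult power2_eq_square mult.assoc mult.left_commute)
  ultimately show ?thesis by simp
qed

lemma tendsto_dilation:
  fixes f :: "complex \<Rightarrow> complex"
  assumes "f holomorphic_on ball 0 1" "cmod w < 1"
  shows "((\<lambda>r. f (of_real (r\<^sup>2) * w)) \<longlongrightarrow> f w) (at_left 1)"
proof -
  have "isCont f w"
    using holomorphic_on_imp_continuous_on[OF assms(1)] assms(2)
    by (simp add: continuous_on_eq_continuous_at)
  moreover have "((\<lambda>r. of_real (r\<^sup>2) * w) \<longlongrightarrow> of_real (1\<^sup>2) * w) (at_left (1::real))"
    by (intro tendsto_intros)
  ultimately show ?thesis by (auto intro: isCont_tendsto_compose)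
qed

text \<open>The reproducing property: the circle integrals equal \<open>f (r^2 * w)\<close>, and
  \<open>r\<close> tends to 1.\<close>

lemma hardy_inner_szego_kernel:
  assumes "f \<in> hardy_space" "cmod w < 1"
  shows "hardy_inner f (szego_kernel w) = f w"
proof -
  have hf: "f holomorphic_on ball 0 1" using assms by (simp add: hardy_space_def)
  have "\<forall>\<^sub>F r in at_left 1. f (of_real (r\<^sup>2) * w) = 1 / (2 * pi) * integral {0..2 * pi}
            (\<lambda>t. f (of_real r * cis t) * cnj (szego_kernel w (of_real r * cis t)))"
    using eventually_at_left_real[of 0 1]
    by (rule eventually_mono)
      (auto simp: integral_unique[OF has_integral_szego_kernel[OF hf assms(2)]])
  with tendsto_dilation[OF hf assms(2)]
  have "((\<lambda>r. 1 / (2 * pi) * integral {0..2 * pi}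
            (\<lambda>t. f (of_real r * cis t) * cnj (szego_kernel w (of_real r * cis t)))) \<longlongrightarrow> f w) (at_left 1)"
    by (rule Lim_transform_eventually)
  from tendsto_unique[OF _ hardy_inner_tendsto this] show ?thesis
    using assms szego_kernel_in_hardy_space by simp
qed

text \<open>Conjugate symmetry is plain for the circle integrals and passes to the limit.\<close>

lemma hardy_inner_commute:
  assumes "f \<in> hardy_space" "g \<in> hardy_space"
  shows "hardy_inner g f = cnj (hardy_inner f g)"
proof -
  have "((\<lambda>r. cnj (1 / (2 * pi) * integral {0..2 * pi}
            (\<lambda>t. f (of_real r * cis t) * cnj (g (of_real r * cis t))))) \<longlongrightarrow> cnj (hardy_inner f g)) (at_left 1)"
    by (intro tendsto_cnj hardy_inner_tendsto assms)
  then have "((\<lambda>r. 1 / (2 * pi) * integral {0..2 * pi}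
            (\<lambda>t. g (of_real r * cis t) * cnj (f (of_real r * cis t)))) \<longlongrightarrow> cnj (hardy_inner f g)) (at_left 1)"
    by (simp add: integral_cnj mult.commute)
  from tendsto_unique[OF _ hardy_inner_tendsto this] show ?thesis
    using assms by simp
qed

text \<open>Pairing \<open>f\<close> composed with \<open>\<phi>\<close> against the kernel at
  \<open>w\<close> gives \<open>f (\<phi> w)\<close>, which is also the pairing of \<open>f\<close>
  with the kernel at \<open>\<phi> w\<close>. The definite description asks for uniqueness
  too.\<close>

lemma hardy_adjoint_composition_szego_kernel:
  assumes phi: "\<phi> holomorphic_on ball 0 1" "\<phi> ` ball 0 1 \<subseteq> ball 0 1" and w: "cmod w < 1"
  shows "hardy_adjoint (composition_operator \<phi>) (szego_kernel w) = szego_kernel (\<phi> w)"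
  unfolding hardy_adjoint_def
proof (rule the_equality)
  have pw: "cmod (\<phi> w) < 1" using phi(2) w by (force simp: image_subset_iff)
  have T: "hardy_inner (composition_operator \<phi> f) (szego_kernel w) = f (\<phi> w)" if "f \<in> hardy_space" for f
    using hardy_inner_szego_kernel[OF hardy_space_compose[OF that phi] w] w
    by (simp add: composition_operator_def)
  show "szego_kernel (\<phi> w) \<in> hardy_space \<and> (\<forall>f\<in>hardy_space.
      hardy_inner (composition_operator \<phi> f) (szego_kernel w) = hardy_inner f (szego_kernel (\<phi> w)))"
    using T pw hardy_inner_szego_kernel szego_kernel_in_hardy_space by simp
  fix h
  assume h: "h \<in> hardy_space \<and> (\<forall>f\<in>hardy_space.
      hardy_inner (composition_operator \<phi> f) (szego_kernel w) = hardy_inner f h)"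
  show "h = szego_kernel (\<phi> w)"
  proof
    fix z
    show "h z = szego_kernel (\<phi> w) z"
    proof (cases "cmod z < 1")
      case True
      then have z: "szego_kernel z \<in> hardy_space" by (rule szego_kernel_in_hardy_space)
      \<comment> \<open>Testing the adjoint equation on the kernel at \<open>z\<close> recovers the
        value of \<open>h\<close> at \<open>z\<close>.\<close>
      have "cnj (h z) = cnj (hardy_inner h (szego_kernel z))"
        using hardy_inner_szego_kernel h True by simp
      also have "\<dots> = hardy_inner (szego_kernel z) h"
        by (rule hardy_inner_commute[symmetric]) (use h z in auto)
      also have "\<dots> = szego_kernel z (\<phi> w)"
        using h z T by simp
      also have "\<dots> = cnj (szego_kernel (\<phi> w) z)"
        using True pw by (simp add: szego_kernel_def mult.commute)
      finally show ?thesis by simp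
    qed (use h in \<open>auto simp: hardy_space_def szego_kernel_def\<close>)
  qed
qed

section \<open>The defining identity on the constant function\<close>

theorem theorem6:
  fixes a b c d :: complex and \<phi> :: "complex \<Rightarrow> complex"
  assumes "linear_fractional_self_map a b c d \<phi>"
    and "a \<noteq> 0" and "c \<noteq> 0" and "\<phi> 0 \<noteq> 0"
  shows "\<not> two_complex_symmetric_with hardy_conjugation (composition_operator \<phi>)"
proof
  assume sym: "two_complex_symmetric_with hardy_conjugation (composition_operator \<phi>)"
  let ?T = "composition_operator \<phi>" and ?J = hardy_conjugation
  let ?one = "szego_kernel 0"
  \<comment> \<open>Conjugates, because the kernel at \<open>w\<close> is
    \<open>1 / (1 - cnj w * z)\<close>.\<close>
  define p q where "p = cnj (\<phi> 0)" and "q = cnj (\<phi> (\<phi> 0))"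
  have phi: "\<phi> holomorphic_on ball 0 1" "\<phi> ` ball 0 1 \<subseteq> ball 0 1"
    using assms(1) by (auto simp: linear_fractional_self_map_def)
  have lt: "cmod (\<phi> z) < 1" if "cmod z < 1" for z
    using phi(2) that by (force simp: image_subset_iff)
  have T1: "?T ?one = ?one"
    by (rule ext) (use lt in \<open>simp add: composition_operator_def szego_kernel_def\<close>)
  have J1: "?J ?one = ?one"
    by (rule ext) (simp add: hardy_conjugation_def szego_kernel_def)
  have A1: "hardy_adjoint ?T ?one = szego_kernel (\<phi> 0)"
    by (intro hardy_adjoint_composition_szego_kernel phi) simp
  have A2: "hardy_adjoint ?T (szego_kernel (\<phi> 0)) = szego_kernel (\<phi> (\<phi> 0))"
    by (intro hardy_adjoint_composition_szego_kernel phi lt) simp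
  have "?one \<in> hardy_space" by (rule szego_kernel_in_hardy_space) simp
  with sym have "(\<lambda>z. ?one z - 2 * szego_kernel (\<phi> 0) z + szego_kernel (\<phi> (\<phi> 0)) z) = (\<lambda>z. 0)"
    unfolding two_complex_symmetric_with_def by (force simp: T1 J1 A1 A2)
  then have eq: "1 - 2 / (1 - p * z) + 1 / (1 - q * z) = 0" if "cmod z < 1" for z
    using that by (auto simp: szego_kernel_def p_def q_def dest!: fun_cong[of _ _ z])
  \<comment> \<open>Clearing denominators leaves a polynomial in \<open>z\<close> whose constant
    term is \<open>1 - 2 + 1 = 0\<close>.\<close>
  have poly: "(q - 2 * p) * z + p * q * z\<^sup>2 = 0" if "cmod z < 1" for z
  proof -
    have "1 - p * z \<noteq> 0" "1 - q * z \<noteq> 0"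
      using one_minus_mult_nonzero[of p z] one_minus_mult_nonzero[of q z] that lt
      by (auto simp: p_def q_def)
    moreover have "A * B * (1 - 2 / A + 1 / B) = A * B - 2 * B + A" if "A \<noteq> 0" "B \<noteq> 0" for A B :: complex
      using that by (simp add: field_simps)
    ultimately have "(1 - p * z) * (1 - q * z) * (1 - 2 / (1 - p * z) + 1 / (1 - q * z))
        = (1 - p * z) * (1 - q * z) - 2 * (1 - q * z) + (1 - p * z)"
      by blast
    also have "\<dots> = (q - 2 * p) * z + p * q * z\<^sup>2"
      by (simp add: algebra_simps power2_eq_square)
    finally show ?thesis using eq[OF that] by simp
  qed
  \<comment> \<open>The values at 1/2 and -1/2, multiplied by 4, separate the odd and even
    coefficients. Then \<open>q = 2 * p\<close> and \<open>p * q = 0\<close> force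
    \<open>p = 0\<close>.\<close>
  have "2 * (q - 2 * p) + p * q = 0" "p * q - 2 * (q - 2 * p) = 0"
    using poly[of "1/2"] poly[of "- (1/2)"] by (auto simp: field_simps power2_eq_square)
  then have "p * q = 0" "q = 2 * p" by algebra+
  then show False using assms(4) by (auto simp: p_def)
qed

end
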